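(* Let $N\ge 1$ be an integer and let $\lambda_1\in\{+,-\}$. Then, as formal (possibly infinite) $\mathbb{Z}$-linear combinations of the independent symbols $x_{b,d}$ with $b\in\{+,-\}^N$, $d\in\mathbb{Z}$, $$ \operatorname{ch}\,[\lambda_1|+)[+^{N-1}|-^{N-1}) =\sum_{n\ge 0}\binom{n+N-1}{N-1}\sum_{\nu=\nu_1\cdots\nu_N\in\{+,-\}^N}(-1)^{|\nu|_-}\, \operatorname{ch}\Big([\lambda_1|\pm)[+^{N-1}|\pm^{N-1})_{[\nu_1\overline{\nu_{2\cdots N}}]\,[2(n+|\nu_{2\cdots N}|_-)]}\Big), $$ where $\nu_{2\cdots N}=\nu_2\cdots\nu_N$ and, for each fixed $(b,d)$, only finitely many terms on the right-hand side contribute to the coefficient of $x_{b,d}$.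
   Context: Bits. $\{+,-\}^m$ is the group $(\mathbb{Z}/2)^m$ written multiplicatively, with componentwise product $\ast$, where $+$ is the identity and $-\ast-=+$. For $\lambda=\lambda_1\cdots\lambda_m\in\{+,-\}^m$, $|\lambda|_-:=|\{i:\lambda_i=-\}|$ and $\overline{\lambda}:=(-\cdots-)\ast\lambda$ (flip all bits). $+^m$ and $-^m$ denote $+\cdots+$ and $-\cdots-$ of length $m$, and $\pm^m$ in the notation below denotes the whole set $\{+,-\}^m$. Concatenation of strings is written by juxtaposition, e.g. $\nu_1\overline{\nu_{2\cdots N}}\in\{+,-\}^N$ has first bit $\nu_1$ and remaining bits $\overline{\nu_2}\cdots\overline{\nu_N}$. Colored node sets. Consider directed acyclic graphs whose nodes are colored by $C_N:=\{+,-\}^N\times\mathbb{Z}$; the color of a node $v$ is $(b(v),d(v))$ ("bits" and "depth"). The character of such a graph $\mathcal{Q}$ is $$\operatorname{ch}\mathcal{Q}:=\sum_{(b,d)\in C_N}\#\{v\in\mathcal{Q}: b(v)=b,\ d(v)=d\}\;x_{b,d},$$ where the $x_{b,d}$ are formal independent symbols. It depends only on the nodes and the coloring, not on the edges or their orientation, so edges are not recorded here. For $\lambda=\lambda_1\cdots\lambda_N\in\{+,-\}^N$ and subsets $E_1\subseteq\{+,-\}$, $E_2\subseteq\{+,-\}^{N-1}$ (a single string denoting the corresponding singleton, and $\pm$, $\pm^{N-1}$ denoting the full set), the graph $[\lambda_1|E_1)[\lambda_{2\cdots N}|E_2)$ has one node for each pair $(k,\mu)$ with $k\in\mathbb{Z}_{\ge0}$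 and $\mu=\mu_1\cdots\mu_N\in\{+,-\}^N$ such that $\mu_1\in E_1$ and $\mu_{2\cdots N}\in E_2$; this node has color $$\big(\lambda\ast\mu,\; 2k+|\lambda|_-+|\mu|_-\big).$$ Shifts. For $\nu\in\{+,-\}^N$, $\mathcal{Q}_{[\nu]}$ is the same graph with each color $(b,d)$ replaced by $(b\ast\nu,\,d+|\nu|_-)$. For an integer $e$, $\mathcal{Q}_{[e]}$ is the same graph with each color $(b,d)$ replaced by $(b,\,d+e)$. $\mathcal{Q}_{[\nu][e]}:=(\mathcal{Q}_{[\nu]})_{[e]}$. In the claim, the subscript shifts are applied to the whole graph $[\lambda_1|\pm)[+^{N-1}|\pm^{N-1})$. *)

theory Defs
  imports Main "HOL-Library.Groups_Big_Fun"
begin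

datatype sign = Plus | Minus

fun sign_mult :: "sign \<Rightarrow> sign \<Rightarrow> sign" where
  "sign_mult Plus t = t"
| "sign_mult Minus Plus = Minus"
| "sign_mult Minus Minus = Plus"

text \<open>Elements of \<open>{+,-}\<close>\<open>\<^sup>m\<close> are the lists of length \<open>m\<close>; concatenation is that of lists.\<close>

type_synonym bits = "sign list"

definition strings :: "nat \<Rightarrow> bits set" where
  "strings m = {l. length l = m}"

text \<open>Only meant for strings of equal length (\<^const>\<open>map2\<close> truncates to the shorter one).\<close>

definition bits_mult :: "bits \<Rightarrow> bits \<Rightarrow> bits" (infixl "\<star>" 70) where
  "l \<star> m = map2 sign_mult l m"

definition neg :: "bits \<Rightarrow> nat" where
  "neg l = card {i. i < length l \<and> l ! i = Minus}"

definition flip :: "bits \<Rightarrow> bits" where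
  "flip l = replicate (length l) Minus \<star> l"

type_synonym color = "bits \<times> int"

definition colors :: "nat \<Rightarrow> color set" where
  "colors N = strings N \<times> UNIV"

text \<open>Characters do not depend on edges, so a graph is given by its nodes and their colors.\<close>

record 'v colored_graph =
  nodes :: "'v set"
  color_of :: "'v \<Rightarrow> color"

text \<open>A formal linear combination of the symbols \<open>x\<^sub>b\<^sub>,\<^sub>d\<close> is its coefficient function.
  Since \<^const>\<open>card\<close> is 0 on infinite sets, this is meaningful only for graphs with finitely many
  nodes of each color; see \<open>locally_finite_graph\<close> and the lemmas below.\<close>

definition ch :: "'v colored_graph \<Rightarrow> color \<Rightarrow> int" where
  "ch Q c = int (card {v \<in> nodes Q. color_of Q v = c})"

text \<open>The graph \<open>[\<lambda>\<^sub>1|E\<^sub>1)[\<lambda>\<^sub>2\<^sub>\<cdots>\<^sub>N|E\<^sub>2)\<close> is \<open>box_graph l1 E1 ls E2\<close> with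
  \<open>E2 \<subseteq> strings (length ls)\<close>, where \<open>length ls = N - 1\<close>.\<close>

definition box_graph ::
  "sign \<Rightarrow> sign set \<Rightarrow> bits \<Rightarrow> bits set \<Rightarrow> (nat \<times> bits) colored_graph" where
  "box_graph l1 E1 ls E2 =
    \<lparr>nodes = {(k, m1 # ms) | k m1 ms. m1 \<in> E1 \<and> ms \<in> E2},
     color_of = (\<lambda>(k, m). ((l1 # ls) \<star> m, 2 * int k + int (neg (l1 # ls)) + int (neg m)))\<rparr>"

definition shift_bits :: "'v colored_graph \<Rightarrow> bits \<Rightarrow> 'v colored_graph" where
  "shift_bits Q n =
    \<lparr>nodes = nodes Q,
     color_of = (\<lambda>v. case color_of Q v of (b, d) \<Rightarrow> (b \<star> n, d + int (neg n)))\<rparr>"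

definition shift_depth :: "'v colored_graph \<Rightarrow> int \<Rightarrow> 'v colored_graph" where
  "shift_depth Q e =
    \<lparr>nodes = nodes Q,
     color_of = (\<lambda>v. case color_of Q v of (b, d) \<Rightarrow> (b, d + e))\<rparr>"

definition locally_finite_graph :: "'v colored_graph \<Rightarrow> bool" where
  "locally_finite_graph Q \<longleftrightarrow> (\<forall>c. finite {v \<in> nodes Q. color_of Q v = c})"

lemma finite_strings: "finite (strings m)"
proof -
  have U: "(UNIV :: sign set) = {Plus, Minus}" using sign.exhaust by auto
  then have "finite (UNIV :: sign set)" by (metis finite.emptyI finite.insertI)
  from finite_lists_length_eq[OF this, of m] show ?thesis
    by (simp add: strings_def)
qed

lemma locally_finite_box_graph:
  assumes "E2 \<subseteq> strings (length ls)"
  shows "locally_finite_graph (box_graph l1 E1 ls E2)"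
  unfolding locally_finite_graph_def
proof
  fix c :: color
  have "{v \<in> nodes (box_graph l1 E1 ls E2). color_of (box_graph l1 E1 ls E2) v = c}
      \<subseteq> {.. nat (snd c)} \<times> strings (Suc (length ls))"
    using assms by (auto simp: box_graph_def strings_def)
  then show "finite {v \<in> nodes (box_graph l1 E1 ls E2). color_of (box_graph l1 E1 ls E2) v = c}"
    by (rule finite_subset) (simp add: finite_strings)
qed

lemma locally_finite_shift_depth:
  assumes "locally_finite_graph Q"
  shows "locally_finite_graph (shift_depth Q e)"
  unfolding locally_finite_graph_def
proof
  fix c :: color
  have "{v \<in> nodes (shift_depth Q e). color_of (shift_depth Q e) v = c}
      \<subseteq> {v \<in> nodes Q. color_of Q v = (fst c, snd c - e)}"
    by (auto simp: shift_depth_def case_prod_beta prod_eq_iff)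
  then show "finite {v \<in> nodes (shift_depth Q e). color_of (shift_depth Q e) v = c}"
    using assms finite_subset unfolding locally_finite_graph_def by blast
qed

lemma locally_finite_shift_bits:
  assumes Q: "locally_finite_graph Q"
    and len: "\<forall>v\<in>nodes Q. fst (color_of Q v) \<in> strings N"
  shows "locally_finite_graph (shift_bits Q n)"
  unfolding locally_finite_graph_def
proof
  fix c :: color
  have "{v \<in> nodes (shift_bits Q n). color_of (shift_bits Q n) v = c}
      \<subseteq> (\<Union>b\<in>strings N. {v \<in> nodes Q. color_of Q v = (b, snd c - int (neg n))})"
    using len by (auto simp: shift_bits_def case_prod_beta prod_eq_iff)
  moreover have "finite \<dots>"
    using Q by (simp add: finite_strings locally_finite_graph_def)
  ultimately show "finite {v \<in> nodes (shift_bits Q n). color_of (shift_bits Q n) v = c}"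
    by (rule finite_subset)
qed

end

theory Submission
  imports Defs
begin

text \<open>Encode the color \<open>(b, d)\<close> by the monomial \<open>y\<^sup>b q\<^sup>d\<close>, where
  \<open>y\<^sub>1, \<dots>, y\<^sub>N\<close> generate the group of sign strings, so that
  \<open>y\<^sub>i\<^sup>2 = 1\<close>. Shifts become multiplication by monomials, and the full graph
  \<open>[\<lambda>\<^sub>1|\<plusminus>)[+|\<plusminus>)\<close> has character
  \<open>(q y\<^sub>1)\<^sup>\<lambda> (1 + q y\<^sub>1) \<cdots> (1 + q y\<^sub>N) / (1 - q\<^sup>2)\<close>.
  The signed sum over \<open>\<nu>\<close> multiplies it by
  \<open>(1 - q y\<^sub>1) (q y\<^sub>2 - q\<^sup>2) \<cdots> (q y\<^sub>N - q\<^sup>2)\<close>. Because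
  \<open>(1 + q y)(1 - q y) = 1 - q\<^sup>2\<close> and
  \<open>(1 + q y)(q y - q\<^sup>2) = q y (1 - q\<^sup>2)\<close>, every bit contributes one factor
  \<open>1 - q\<^sup>2\<close>; the binomial sum over \<open>n\<close> is the expansion of
  \<open>(1 - q\<^sup>2)\<close> to the power \<open>-N\<close> and cancels them. What is left,
  \<open>(q y\<^sub>1)\<^sup>\<lambda> q y\<^sub>2 \<cdots> q y\<^sub>N / (1 - q\<^sup>2)\<close>, is the character of
  \<open>[\<lambda>\<^sub>1|+)[+|-)\<close>.

  The proof reads this off one coefficient at a time. For fixed bits, the equation between colors
  determines the string \<open>\<mu>\<close> of a node, so a coefficient of a box graph is the coefficient
  of \<open>1 / (1 - q\<^sup>2)\<close> at a shifted depth (\<open>ch_box_graph\<close>). Multiplication by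
  \<open>1 - q\<^sup>2\<close> turns into the difference operator \<open>diff2\<close>. Summing over the signs bit
  by bit then yields an \<open>N\<close>-fold difference (\<open>sum_strings_head_tail\<close>), which
  \<open>sum_binomial_funpow_diff2\<close> inverts.\<close>

section \<open>Strings of signs\<close>

lemma sign_mult_eq_iff_left: "sign_mult a b = c \<longleftrightarrow> b = sign_mult a c"
  by (cases a; cases b; cases c) auto

lemma sign_mult_eq_iff_right: "sign_mult a b = c \<longleftrightarrow> a = sign_mult c b"
  by (cases a; cases b; cases c) auto

lemma neg_simps [simp]:
  "neg [] = 0"
  "neg (s # l) = (if s = Minus then 1 else 0) + neg l"
proof -
  have "neg l = length (filter (\<lambda>t. t = Minus) l)" for l
    by (simp add: neg_def length_filter_conv_card)
  then show "neg [] = 0" "neg (s # l) = (if s = Minus then 1 else 0) + neg l"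
    by simp_all
qed

lemma neg_replicate [simp]:
  "neg (replicate m Plus) = 0" "neg (replicate m Minus) = m"
  by (induction m) auto

lemma bits_mult_simps [simp]:
  "[] \<star> l = []"
  "(s # l) \<star> (t # m) = sign_mult s t # (l \<star> m)"
  by (simp_all add: bits_mult_def)

lemma length_bits_mult [simp]: "length (l \<star> m) = min (length l) (length m)"
  by (simp add: bits_mult_def)

lemma replicate_Plus_mult [simp]: "length l = m \<Longrightarrow> replicate m Plus \<star> l = l"
  by (induction l arbitrary: m) auto

lemma flip_simps [simp]:
  "flip [] = []"
  "flip (s # l) = sign_mult Minus s # flip l"
  by (simp_all add: flip_def)

lemma length_flip [simp]: "length (flip l) = length l"
  by (simp add: flip_def)

lemma bits_mult_eq_iff_left:
  assumes "length l = length b" "length m = length b"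
  shows "l \<star> m = b \<longleftrightarrow> m = l \<star> b"
  using assms
proof (induction l arbitrary: m b)
  case (Cons s l)
  then obtain t m' u b' where "m = t # m'" "b = u # b'"
    by (metis length_Suc_conv)
  with Cons show ?case
    using sign_mult_eq_iff_left[of s t u] by auto
qed simp

lemma bits_mult_eq_iff_right:
  assumes "length l = length b" "length m = length b"
  shows "l \<star> m = b \<longleftrightarrow> l = b \<star> m"
  using assms
proof (induction l arbitrary: m b)
  case (Cons s l)
  then obtain t m' u b' where "m = t # m'" "b = u # b'"
    by (metis length_Suc_conv)
  with Cons show ?case
    using sign_mult_eq_iff_right[of s t u] by auto
qed simp

lemma strings_0 [simp]: "strings 0 = {[]}"
  by (auto simp: strings_def)

lemma sum_strings_Suc:
  "(\<Sum>\<nu>\<in>strings (Suc m). g \<nu>) = (\<Sum>\<nu>\<in>strings m. g (Plus # \<nu>) + g (Minus # \<nu>))"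
  for g :: "bits \<Rightarrow> int"
proof -
  have split: "strings (Suc m) = Cons Plus ` strings m \<union> Cons Minus ` strings m"
    by (auto simp: strings_def length_Suc_conv image_iff) (metis sign.exhaust)
  show ?thesis
    unfolding split
    by (subst sum.union_disjoint) (auto simp: finite_strings sum.reindex sum.distrib)
qed

section \<open>Coefficients of characters\<close>

text \<open>The coefficient of \<open>q\<^sup>e\<close> in \<open>1 / (1 - q\<^sup>2)\<close>.\<close>

definition even_nonneg :: "int \<Rightarrow> int" where
  "even_nonneg e = (if even e \<and> 0 \<le> e then 1 else 0)"

lemma ch_shift_depth: "ch (shift_depth Q e) (b, d) = ch Q (b, d - e)"
proof -
  have "{v \<in> nodes Q. color_of (shift_depth Q e) v = (b, d)} =
      {v \<in> nodes Q. color_of Q v = (b, d - e)}"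
    by (auto simp: shift_depth_def case_prod_beta prod_eq_iff)
  then show ?thesis
    by (simp add: ch_def) (simp add: shift_depth_def)
qed

lemma ch_shift_bits:
  assumes "\<forall>v\<in>nodes Q. fst (color_of Q v) \<in> strings N" "b \<in> strings N" "n \<in> strings N"
  shows "ch (shift_bits Q n) (b, d) = ch Q (b \<star> n, d - int (neg n))"
proof -
  have "color_of (shift_bits Q n) v = (b, d) \<longleftrightarrow> color_of Q v = (b \<star> n, d - int (neg n))"
    if "v \<in> nodes Q" for v
  proof -
    have "fst (color_of Q v) \<star> n = b \<longleftrightarrow> fst (color_of Q v) = b \<star> n"
      using assms that by (intro bits_mult_eq_iff_right) (simp_all add: strings_def)
    then show ?thesis
      by (auto simp: shift_bits_def case_prod_beta prod_eq_iff)
  qed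
  then have "{v \<in> nodes Q. color_of (shift_bits Q n) v = (b, d)} =
      {v \<in> nodes Q. color_of Q v = (b \<star> n, d - int (neg n))}"
    by blast
  then show ?thesis
    by (simp add: ch_def) (simp add: shift_bits_def)
qed

text \<open>The bits of a node's color determine its string \<open>\<mu>\<close>, since every string of signs is
  its own inverse; the depth then determines \<open>k\<close>. Hence each color occurs at most once.\<close>

lemma ch_box_graph:
  assumes E2: "E2 \<subseteq> strings (length ls)" and b: "length bs = length ls"
  shows "ch (box_graph l1 E1 ls E2) (b1 # bs, d) =
    (if sign_mult l1 b1 \<in> E1 \<and> ls \<star> bs \<in> E2
     then even_nonneg (d - int (neg (l1 # ls)) - int (neg ((l1 # ls) \<star> (b1 # bs)))) else 0)"
proof -
  let ?e = "d - int (neg (l1 # ls)) - int (neg ((l1 # ls) \<star> (b1 # bs)))"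
  let ?V = "{v \<in> nodes (box_graph l1 E1 ls E2). color_of (box_graph l1 E1 ls E2) v = (b1 # bs, d)}"
  have V: "?V = {(k, m1 # ms) | k m1 ms. m1 \<in> E1 \<and> ms \<in> E2 \<and>
      m1 = sign_mult l1 b1 \<and> ms = ls \<star> bs \<and> 2 * int k = ?e}" (is "_ = ?W")
  proof -
    have tail: "ls \<star> ms = bs \<longleftrightarrow> ms = ls \<star> bs" if "ms \<in> E2" for ms
      using bits_mult_eq_iff_left[of ls bs ms] that E2 b by (auto simp: strings_def)
    have "v \<in> ?V \<longleftrightarrow> (\<exists>k m1 ms. v = (k, m1 # ms) \<and> m1 \<in> E1 \<and> ms \<in> E2 \<and>
        sign_mult l1 m1 = b1 \<and> ls \<star> ms = bs \<and>
        2 * int k + int (neg (l1 # ls)) + int (neg (m1 # ms)) = d)" for v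
      by (auto simp: box_graph_def simp del: neg_simps)
    moreover have "sign_mult l1 m1 = b1 \<and> ls \<star> ms = bs \<and>
        2 * int k + int (neg (l1 # ls)) + int (neg (m1 # ms)) = d \<longleftrightarrow>
        m1 = sign_mult l1 b1 \<and> ms = ls \<star> bs \<and> 2 * int k = ?e"
      if "ms \<in> E2" for k m1 ms
      unfolding sign_mult_eq_iff_left[of l1 m1] tail[OF that] bits_mult_simps
      by (auto simp del: neg_simps)
    ultimately show ?thesis
      by (simp cong: conj_cong)
  qed
  have half: "card {k. 2 * int k = e} = (if even e \<and> 0 \<le> e then 1 else 0)" for e
  proof (cases "even e \<and> 0 \<le> e")
    case True
    then have "{k. 2 * int k = e} = {nat (e div 2)}"
      by auto
    with True show ?thesis by simp
  next
    case False
    then have "{k. 2 * int k = e} = {}"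
      by auto
    with False show ?thesis by (simp only: card.empty if_False)
  qed
  show ?thesis
  proof (cases "sign_mult l1 b1 \<in> E1 \<and> ls \<star> bs \<in> E2")
    case True
    then have "?W = (\<lambda>k. (k, sign_mult l1 b1 # (ls \<star> bs))) ` {k. 2 * int k = ?e}"
      by (simp only: image_Collect) blast
    moreover have "inj_on (\<lambda>k. (k, sign_mult l1 b1 # (ls \<star> bs))) {k. 2 * int k = ?e}"
      by (simp add: inj_on_def)
    ultimately have "card ?V = card {k. 2 * int k = ?e}"
      unfolding V by (simp only: card_image)
    with True show ?thesis
      unfolding ch_def half even_nonneg_def by (simp only: if_True of_nat_1 of_nat_0 split: if_split) simp
  next
    case False
    then have "?W = {}"
      by blast
    with False show ?thesis
      unfolding ch_def V by (simp only: if_False card.empty of_nat_0)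
  qed
qed

section \<open>Differences with step two\<close>

text \<open>Multiplication of a Laurent series by \<open>1 - q\<^sup>2\<close>, on coefficients.\<close>

definition diff2 :: "(int \<Rightarrow> int) \<Rightarrow> int \<Rightarrow> int" where
  "diff2 f e = f e - f (e - 2)"

lemma diff2_funpow_vanishes:
  "(\<And>e. e < 0 \<Longrightarrow> f e = 0) \<Longrightarrow> e < 0 \<Longrightarrow> (diff2 ^^ m) f e = 0"
  by (induction m arbitrary: e) (auto simp: diff2_def)

text \<open>Summation by parts: by Pascal's rule the difference of consecutive binomial coefficients
  has its lower index decreased by one, at the price of a boundary term.\<close>

lemma sum_binomial_diff2:
  "(\<Sum>n\<le>M. int ((n + Suc m) choose Suc m) * diff2 g (e - 2 * int n)) =
    (\<Sum>n\<le>M. int ((n + m) choose m) * g (e - 2 * int n))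
    - int ((M + Suc m) choose Suc m) * g (e - 2 * int M - 2)"
proof (induction M)
  case 0
  then show ?case by (simp add: diff2_def)
next
  case (Suc M)
  have pascal: "int ((Suc M + Suc m) choose Suc m) =
      int ((Suc M + m) choose m) + int ((M + Suc m) choose Suc m)"
    by simp
  have shift: "g (e - 2 * int M - 2) = g (e - 2 * int (Suc M))"
    by (simp add: algebra_simps)
  show ?case
    unfolding sum.atMost_Suc Suc.IH shift
    unfolding diff2_def pascal by (simp only: ring_distribs)
qed

text \<open>Multiplication by \<open>(1 - q\<^sup>2)\<close> to the power \<open>m + 1\<close>, followed by
  multiplication with the binomial series of the inverse, is the identity. The bound on \<open>e\<close>
  makes the boundary terms of the summation by parts fall where \<open>f\<close> vanishes.\<close>

lemma sum_binomial_funpow_diff2: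
  assumes "\<And>e. e < 0 \<Longrightarrow> f e = 0" and "e < 2 * int M + 2"
  shows "(\<Sum>n\<le>M. int ((n + m) choose m) * (diff2 ^^ Suc m) f (e - 2 * int n)) = f e"
proof (induction m)
  case 0
  have "(\<Sum>n\<le>K. diff2 f (e - 2 * int n)) = f e - f (e - 2 * int K - 2)" for K
    by (induction K) (simp_all add: diff2_def algebra_simps)
  with assms show ?case by simp
next
  case (Suc m)
  have "(diff2 ^^ Suc m) f (e - 2 * int M - 2) = 0"
    using assms by (intro diff2_funpow_vanishes) auto
  with Suc sum_binomial_diff2[where m = m and g = "(diff2 ^^ Suc m) f" and e = e and M = M] show ?case
    by simp
qed

text \<open>The coefficient of \<open>y\<^sup>b\<close> in the product of the factors
  \<open>(1 + q y)(q y - q\<^sup>2) = q y (1 - q\<^sup>2)\<close>. In a bit where \<open>b\<close> is \<open>+\<close>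
  the terms for \<open>\<nu> = +\<close> and \<open>\<nu> = -\<close> both have weight 2 and cancel; where
  \<open>b\<close> is \<open>-\<close> they have weights 1 and 3, which gives a difference with step 2.\<close>

lemma sum_strings_tail:
  "(\<Sum>\<nu>\<in>strings (length b). (-1) ^ neg \<nu> *
      f (e - int (neg (b \<star> flip \<nu>) + neg (flip \<nu>) + 2 * neg \<nu>))) =
    (if b = replicate (length b) Minus then (diff2 ^^ length b) f (e - int (length b)) else 0)"
proof (induction b arbitrary: e)
  case Nil
  then show ?case by simp
next
  case (Cons s b)
  define S where "S e = (\<Sum>\<nu>\<in>strings (length b). (-1) ^ neg \<nu> *
      f (e - int (neg (b \<star> flip \<nu>) + neg (flip \<nu>) + 2 * neg \<nu>)))" for e
  have "(\<Sum>\<nu>\<in>strings (length (s # b)). (-1) ^ neg \<nu> *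
      f (e - int (neg ((s # b) \<star> flip \<nu>) + neg (flip \<nu>) + 2 * neg \<nu>))) =
    S (e - (if s = Plus then 2 else 1)) - S (e - (if s = Plus then 2 else 3))"
    unfolding S_def length_Cons sum_strings_Suc sum_subtractf[symmetric]
    by (cases s) (auto intro!: sum.cong simp: algebra_simps)
  also have "\<dots> = (if s # b = replicate (length (s # b)) Minus
      then (diff2 ^^ length (s # b)) f (e - int (length (s # b))) else 0)"
    using Cons.IH unfolding S_def[symmetric]
    by (cases s) (auto simp: diff2_def algebra_simps)
  finally show ?case .
qed

text \<open>The first bit is not flipped, and its factor is \<open>(1 + q y)(1 - q y) = 1 - q\<^sup>2\<close>:
  the weights are 0 and 2 if \<open>s\<close> is \<open>+\<close>, and both 1 if \<open>s\<close> is \<open>-\<close>.\<close>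

lemma sum_strings_head_tail:
  "(\<Sum>\<nu>\<in>strings (Suc (length b)). (-1) ^ neg \<nu> *
      f (e - int (neg (sign_mult s (hd \<nu>) # (b \<star> flip (tl \<nu>))) + neg (hd \<nu> # flip (tl \<nu>))
        + 2 * neg (tl \<nu>)))) =
    (if s = Plus \<and> b = replicate (length b) Minus
     then (diff2 ^^ Suc (length b)) f (e - int (length b)) else 0)" (is "?L = _")
proof -
  define S where "S e = (\<Sum>\<nu>\<in>strings (length b). (-1) ^ neg \<nu> *
      f (e - int (neg (b \<star> flip \<nu>) + neg (flip \<nu>) + 2 * neg \<nu>)))" for e
  have "?L = S (e - (if s = Plus then 0 else 1)) - S (e - (if s = Plus then 2 else 1))"
    unfolding S_def length_Cons sum_strings_Suc sum_subtractf[symmetric]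
    by (cases s) (auto intro!: sum.cong simp: algebra_simps)
  then show ?thesis
    using sum_strings_tail[where b = b and f = f] unfolding S_def[symmetric]
    by (cases s) (auto simp: diff2_def algebra_simps)
qed

section \<open>The character identity\<close>

theorem mainTheorem1:
  fixes N :: nat and l1 :: sign
  assumes "N \<ge> 1"
  shows
    "let Q = box_graph l1 {Plus, Minus} (replicate (N - 1) Plus) (strings (N - 1));
         T = (\<lambda>n \<nu>. ch (shift_depth (shift_bits Q (hd \<nu> # flip (tl \<nu>)))
                                    (2 * (int n + int (neg (tl \<nu>))))))
     in \<forall>c \<in> colors N.
          finite {(n :: nat, \<nu>). \<nu> \<in> strings N \<and> T n \<nu> c \<noteq> 0} \<and>
          ch (box_graph l1 {Plus} (replicate (N - 1) Plus) {replicate (N - 1) Minus}) c =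
            Sum_any (\<lambda>n :: nat. int ((n + N - 1) choose (N - 1)) *
              (\<Sum>\<nu> \<in> strings N. (-1) ^ neg \<nu> * T n \<nu> c))"
proof -
  from assms obtain m where N: "N = Suc m"
    by (cases N) auto
  define Q where "Q = box_graph l1 {Plus, Minus} (replicate m Plus) (strings m)"
  define T where "T = (\<lambda>n \<nu>. ch (shift_depth (shift_bits Q (hd \<nu> # flip (tl \<nu>)))
                                    (2 * (int n + int (neg (tl \<nu>))))))"
  have "finite {(n, \<nu>). \<nu> \<in> strings N \<and> T n \<nu> c \<noteq> 0} \<and>
      ch (box_graph l1 {Plus} (replicate m Plus) {replicate m Minus}) c =
        Sum_any (\<lambda>n. int ((n + m) choose m) * (\<Sum>\<nu> \<in> strings N. (-1) ^ neg \<nu> * T n \<nu> c))"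
    if c_color: "c \<in> colors N" for c
  proof -
    obtain b1 bs d where c: "c = (b1 # bs, d)" and bs: "length bs = m"
      using c_color by (auto simp: colors_def strings_def N length_Suc_conv)
    \<comment> \<open>All graphs involved carry the constant depth contribution of \<open>\<lambda>\<^sub>1\<close>; it is removed here.\<close>
    define d' where "d' = d - int (neg [l1])"
    have T_eq: "T n \<nu> c = even_nonneg (d' - 2 * int n -
        int (neg (sign_mult (sign_mult l1 b1) (hd \<nu>) # (bs \<star> flip (tl \<nu>)))
          + neg (hd \<nu> # flip (tl \<nu>)) + 2 * neg (tl \<nu>)))"
      if \<nu>_string: "\<nu> \<in> strings N" for n \<nu>
    proof -
      obtain s \<mu> where \<nu>: "\<nu> = s # \<mu>" "length \<mu> = m"
        using \<nu>_string by (auto simp: strings_def N length_Suc_conv)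
      have assoc: "sign_mult l1 (sign_mult b1 s) = sign_mult (sign_mult l1 b1) s"
        by (cases l1; cases b1; cases s) auto
      have Q_bits: "\<forall>v\<in>nodes Q. fst (color_of Q v) \<in> strings N"
        by (auto simp: Q_def box_graph_def strings_def N)
      have mem: "t \<in> {Plus, Minus}" for t
        using sign.exhaust by auto
      have "T n \<nu> c = ch Q ((b1 # bs) \<star> (s # flip \<mu>),
          d - 2 * (int n + int (neg \<mu>)) - int (neg (s # flip \<mu>)))"
        using \<nu> bs unfolding T_def c ch_shift_depth
        by (subst ch_shift_bits[OF Q_bits]) (auto simp: strings_def N)
      also have "\<dots> = even_nonneg (d' - 2 * int n -
        int (neg (sign_mult (sign_mult l1 b1) s # (bs \<star> flip \<mu>))
          + neg (s # flip \<mu>) + 2 * neg \<mu>))"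
        unfolding Q_def bits_mult_simps
        by (subst ch_box_graph) (use \<nu> bs mem in \<open>auto simp: strings_def d'_def assoc algebra_simps\<close>)
      finally show ?thesis
        by (simp add: \<nu>)
    qed
    \<comment> \<open>All depths in the shifted graphs are at least \<open>2 n\<close>, so \<open>n\<close> is bounded by \<open>d\<close>.\<close>
    have large: "n \<le> nat d" if "\<nu> \<in> strings N" "T n \<nu> c \<noteq> 0" for n \<nu>
      using that by (auto simp: T_eq even_nonneg_def d'_def split: if_splits)
    have "finite {(n, \<nu>). \<nu> \<in> strings N \<and> T n \<nu> c \<noteq> 0}"
      by (rule finite_subset[of _ "{..nat d} \<times> strings N"]) (use large in \<open>auto simp: finite_strings\<close>)
    moreover have "Sum_any (\<lambda>n. int ((n + m) choose m) * (\<Sum>\<nu> \<in> strings N. (-1) ^ neg \<nu> * T n \<nu> c)) =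
        ch (box_graph l1 {Plus} (replicate m Plus) {replicate m Minus}) c"
    proof -
      let ?P = "sign_mult l1 b1 = Plus \<and> bs = replicate m Minus"
      have inner: "(\<Sum>\<nu> \<in> strings N. (-1) ^ neg \<nu> * T n \<nu> c) =
          (if ?P then (diff2 ^^ Suc m) even_nonneg (d' - int m - 2 * int n) else 0)" for n
        using sum_strings_head_tail[where b = bs and f = even_nonneg and e = "d' - 2 * int n" and s = "sign_mult l1 b1"]
        by (simp add: T_eq N bs algebra_simps cong: sum.cong)
      have "Sum_any (\<lambda>n. int ((n + m) choose m) * (\<Sum>\<nu> \<in> strings N. (-1) ^ neg \<nu> * T n \<nu> c)) =
          (\<Sum>n\<le>nat d. int ((n + m) choose m) * (\<Sum>\<nu> \<in> strings N. (-1) ^ neg \<nu> * T n \<nu> c))"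
      proof (rule Sum_any.expand_superset)
        show "{n. int ((n + m) choose m) * (\<Sum>\<nu> \<in> strings N. (-1) ^ neg \<nu> * T n \<nu> c) \<noteq> 0} \<subseteq> {..nat d}"
          using large by (auto elim!: sum.not_neutral_contains_not_neutral)
      qed simp
      also have "\<dots> = (if ?P then even_nonneg (d' - int m) else 0)"
      proof (cases ?P)
        case True
        have "e < 0 \<Longrightarrow> even_nonneg e = 0" for e
          by (simp add: even_nonneg_def)
        moreover have "d' - int m < 2 * int (nat d) + 2"
          by (simp add: d'_def)
        ultimately have "(\<Sum>n\<le>nat d. int ((n + m) choose m) *
            (diff2 ^^ Suc m) even_nonneg (d' - int m - 2 * int n)) = even_nonneg (d' - int m)"
          by (rule sum_binomial_funpow_diff2)
        with True show ?thesis
          unfolding inner by (simp only: if_True simp_thms)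
      next
        case False
        then show ?thesis
          unfolding inner by (simp only: if_False mult_zero_right sum.neutral_const)
      qed
      also have "\<dots> = ch (box_graph l1 {Plus} (replicate m Plus) {replicate m Minus}) c"
        unfolding c by (subst ch_box_graph) (auto simp: bs strings_def d'_def)
      finally show ?thesis .
    qed
    ultimately show ?thesis by simp
  qed
  then show ?thesis
    by (simp add: Let_def N Q_def T_def)
qed

end
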